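(* Let $\mathcal{P}$ be a third-order, $n$-dimensional stochastic tensor, let $v\in\mathbb{R}^n$ be a stochastic vector, and let $0\le\alpha<1/2$. Let $R$ be the $n\times n^2$ flattening of $\mathcal{P}$ along the first index, and let $$f(x)=\alpha R(x\otimes x)+(1-\alpha)v-x .$$ Consider Newton's method for solving $f(x)=0$, and hence for computing the unique multilinear PageRank vector, given by $x_0=0$ and $$\bigl[I-\alpha R(x_k\otimes I+I\otimes x_k)\bigr]p_k=f(x_k),\qquad x_{k+1}=x_k+p_k .$$ This iteration produces a unique (well-defined) sequence of iterates, and for every $k\ge 1$ $$f(x_k)\ge 0\ \text{(entrywise)},\qquad e^Tf(x_k)=\frac{\alpha\,(e^Tf(x_{k-1}))^2}{(1-2\alpha)^2+4\alpha\,e^Tf(x_{k-1})}\le\alpha(1-\alpha)^2\frac{1}{4^{k-1}} .$$ Moreover, the sequence converges quadratically, in the limit $k\to\infty$, to the multilinear PageRank vector.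
   Context: A vector is stochastic if its entries are nonnegative and sum to $1$. A third-order, $n$-dimensional tensor $\mathcal{P}$ has entries $\mathcal{P}_{ijk}$ with $i,j,k\in\{1,\dots,n\}$; it is stochastic if its entries are nonnegative and $\sum_i\mathcal{P}_{ijk}=1$ for all $j,k$. The flattening along the first index is the $n\times n^2$ matrix $R=[\mathcal{P}(:,:,1)\ |\ \cdots\ |\ \mathcal{P}(:,:,n)]$, so $[R(y\otimes x)]_i=\sum_{j,k}\mathcal{P}_{ijk}x_jy_k$. Here $\otimes$ is the Kronecker product, $I$ is the $n\times n$ identity, and $e$ is the all-ones vector. The multilinear PageRank vector is the stochastic vector $x$ with $x=\alpha R(x\otimes x)+(1-\alpha)v$; it exists and is unique for $\alpha<1/2$. Quadratic convergence of $x_k$ to $x$ means that $x_k\to x$ and there is a constant $C$ with $\|x_{k+1}-x\|\le C\|x_k-x\|^2$ for all sufficiently large $k$. *)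

theory Defs
  imports "HOL-Analysis.Analysis"
begin

definition stochastic_vec :: "real^'n \<Rightarrow> bool" where
  "stochastic_vec x \<longleftrightarrow> (\<forall>i. 0 \<le> x $ i) \<and> (\<Sum>i\<in>UNIV. x $ i) = 1"

text \<open>A third-order tensor is an element \<open>P\<close> of \<open>real^'n^'n^'n\<close>, with entries \<open>P $ i $ j $ k\<close>.\<close>

definition stochastic_tensor :: "real^'n^'n^'n \<Rightarrow> bool" where
  "stochastic_tensor P \<longleftrightarrow>
     (\<forall>i j k. 0 \<le> P $ i $ j $ k) \<and> (\<forall>j k. (\<Sum>i\<in>UNIV. P $ i $ j $ k) = 1)"

text \<open>
  Indices of vectors of dimension \<open>n^2\<close> are pairs; the first component is the block index and
  the second one the index inside the block. Column \<open>j\<close> of block \<open>k\<close> of the flattening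
  is therefore column \<open>(k, j)\<close>, and it contains the entries \<open>P $ i $ j $ k\<close>.
\<close>

definition flattening :: "real^'n^'n^'n \<Rightarrow> real^('n \<times> 'n)^'n" where
  "flattening P = (\<chi> i c. P $ i $ snd c $ fst c)"

text \<open>
  The Kronecker product of two column vectors, of a column vector with a matrix, and of a matrix
  with a column vector. They are kept apart because the column index set of a column vector,
  a one-element set, is dropped.
\<close>

definition kron_vec_vec :: "real^'a \<Rightarrow> real^'b \<Rightarrow> real^('a \<times> 'b)" where
  "kron_vec_vec x y = (\<chi> r. x $ fst r * y $ snd r)"

definition kron_vec_mat :: "real^'a \<Rightarrow> real^'c^'b \<Rightarrow> real^'c^('a \<times> 'b)" where
  "kron_vec_mat x B = (\<chi> r c. x $ fst r * B $ snd r $ c)"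

definition kron_mat_vec :: "real^'c^'a \<Rightarrow> real^'b \<Rightarrow> real^'c^('a \<times> 'b)" where
  "kron_mat_vec A y = (\<chi> r c. A $ fst r $ c * y $ snd r)"

definition multilinear_pagerank ::
  "real \<Rightarrow> real^('n \<times> 'n)^'n \<Rightarrow> real^'n \<Rightarrow> real^'n \<Rightarrow> bool" where
  "multilinear_pagerank \<alpha> R v x \<longleftrightarrow>
     stochastic_vec x \<and> x = \<alpha> *\<^sub>R (R *v kron_vec_vec x x) + (1 - \<alpha>) *\<^sub>R v"

definition residual ::
  "real \<Rightarrow> real^('n \<times> 'n)^'n \<Rightarrow> real^'n \<Rightarrow> real^'n \<Rightarrow> real^'n" where
  "residual \<alpha> R v x = \<alpha> *\<^sub>R (R *v kron_vec_vec x x) + (1 - \<alpha>) *\<^sub>R v - x"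

definition newton_matrix :: "real \<Rightarrow> real^('n \<times> 'n)^'n \<Rightarrow> real^'n \<Rightarrow> real^'n^'n" where
  "newton_matrix \<alpha> R x =
     mat 1 - \<alpha> *\<^sub>R (R ** (kron_vec_mat x (mat 1) + kron_mat_vec (mat 1) x))"

definition newton_iterates ::
  "real \<Rightarrow> real^('n \<times> 'n)^'n \<Rightarrow> real^'n \<Rightarrow> (nat \<Rightarrow> real^'n) \<Rightarrow> bool" where
  "newton_iterates \<alpha> R v x \<longleftrightarrow>
     x 0 = 0 \<and>
     (\<forall>k. \<exists>p. newton_matrix \<alpha> R (x k) *v p = residual \<alpha> R v (x k) \<and> x (Suc k) = x k + p)"

definition converges_quadratically ::
  "(nat \<Rightarrow> 'a::real_normed_vector) \<Rightarrow> 'a \<Rightarrow> bool" where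
  "converges_quadratically x l \<longleftrightarrow>
     x \<longlonglongrightarrow> l \<and>
     (\<exists>C. \<forall>\<^sub>F k in sequentially. norm (x (Suc k) - l) \<le> C * (norm (x k - l))\<^sup>2)"

text \<open>The number \<open>e\<^sup>T y\<close>, where \<open>e = vec 1\<close> is the all-ones vector.\<close>

definition entry_sum :: "real^'n \<Rightarrow> real" where
  "entry_sum y = vec 1 \<bullet> y"

end

theory Submission
  imports Defs
begin

text \<open>
  Write \<open>s = entry_sum x\<close> and \<open>F = entry_sum (residual \<alpha> R v x)\<close>. Since the columns of the
  flattening sum to one, \<open>entry_sum (R *v kron_vec_vec x y) = entry_sum x * entry_sum y\<close>, so that
  \<open>F = \<alpha> s\<^sup>2 - s + (1 - \<alpha>) = (1 - s) (1 - \<alpha> - \<alpha> s)\<close>: the entry sums of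
  the iterates are the scalar Newton iteration for this function of \<open>s\<close>, from 0 up to its root 1.

  A nonnegative linear map that multiplies every entry sum by some \<open>c < 1\<close> can be subtracted from
  the identity to leave an invertible map with a nonnegative inverse
  (\<open>contraction_solution_nonneg\<close>, \<open>contraction_solution_unique\<close>). For \<open>x \<ge> 0\<close> with
  \<open>s \<le> 1\<close> the Newton matrix has this form with \<open>c = 2 \<alpha> s \<le> 2 \<alpha> < 1\<close>. So the
  Newton step \<open>p\<close> exists, is unique, and is nonnegative as soon as the residual is. The residual
  is quadratic, hence the next one is exactly the second-order term
  \<open>\<alpha> R (p \<otimes> p) \<ge> 0\<close>; its entry sum is
  \<open>\<alpha> (entry_sum p)\<^sup>2 = \<alpha> F\<^sup>2 / (1 - 2 \<alpha> s)\<^sup>2\<close>, and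
  \<open>(1 - 2 \<alpha> s)\<^sup>2 = (1 - 2 \<alpha>)\<^sup>2 + 4 \<alpha> F\<close>. Thus \<open>F\<close> shrinks by a factor of
  at least 4 in each step. The first step starts from \<open>F = 1 - \<alpha>\<close>, where the denominator is 1,
  and this gives the constant \<open>\<alpha> (1 - \<alpha>)\<^sup>2\<close>.

  The iterates increase entrywise and their entry sums stay below 1, so they converge; as \<open>F\<close>
  tends to 0, the limit \<open>z\<close> is a multilinear PageRank vector. Any such vector is unique, because
  the difference of two of them is fixed by a map that multiplies entry sums by \<open>2 \<alpha>\<close>. Finally,
  \<open>x k \<le> z\<close> makes \<open>1 - s\<close> the 1-norm of the error, and quadratic convergence is the scalar
  identity \<open>1 - s' = \<alpha> (1 - s)\<^sup>2 / (1 - 2 \<alpha> s)\<close> for consecutive entry sums \<open>s\<close> and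
  \<open>s'\<close>.
\<close>

section \<open>Entry sums and Kronecker products\<close>

lemma entry_sum_eq_sum: "entry_sum y = (\<Sum>i\<in>UNIV. y $ i)"
  by (simp add: entry_sum_def inner_vec_def)

lemma linear_entry_sum: "linear entry_sum"
  unfolding entry_sum_def by (rule bounded_linear.linear[OF bounded_linear_inner_right])

lemmas entry_sum_add = linear_add[OF linear_entry_sum]
  and entry_sum_diff = linear_diff[OF linear_entry_sum]
  and entry_sum_scaleR = linear_scale[OF linear_entry_sum]
  and entry_sum_zero = linear_0[OF linear_entry_sum]

lemma entry_sum_nonneg: "0 \<le> y \<Longrightarrow> 0 \<le> entry_sum y"
  by (simp add: entry_sum_eq_sum less_eq_vec_def sum_nonneg)

lemma entry_sum_mono: "x \<le> y \<Longrightarrow> entry_sum x \<le> entry_sum y"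
  by (simp add: entry_sum_eq_sum less_eq_vec_def sum_mono)

lemma entry_le_entry_sum: "0 \<le> y \<Longrightarrow> y $ i \<le> entry_sum y"
  unfolding entry_sum_eq_sum by (rule member_le_sum) (auto simp: less_eq_vec_def)

lemma entry_sum_zero_imp_zero: "0 \<le> y \<Longrightarrow> entry_sum y \<le> 0 \<Longrightarrow> y = 0"
  by (metis entry_le_entry_sum less_eq_vec_def order_antisym order_trans zero_index vec_eq_iff)

lemma norm_le_entry_sum: "0 \<le> y \<Longrightarrow> norm y \<le> entry_sum y"
  using norm_le_l1_cart[of y] by (simp add: entry_sum_eq_sum less_eq_vec_def)

lemma stochastic_vec_iff: "stochastic_vec x \<longleftrightarrow> 0 \<le> x \<and> entry_sum x = 1"
  by (simp add: stochastic_vec_def entry_sum_eq_sum less_eq_vec_def)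

lemma bilinear_mult_kron: "bilinear (\<lambda>x y. R *v kron_vec_vec x y)"
  by (auto simp: bilinear_def kron_vec_vec_def matrix_vector_mult_def vec_eq_iff
      algebra_simps sum.distrib sum_distrib_left intro!: linearI)

lemmas kron_ladd = bilinear_ladd[OF bilinear_mult_kron]
  and kron_radd = bilinear_radd[OF bilinear_mult_kron]
  and kron_lsub = bilinear_lsub[OF bilinear_mult_kron]
  and kron_rsub = bilinear_rsub[OF bilinear_mult_kron]

lemma entry_sum_kron: "entry_sum (kron_vec_vec x y) = entry_sum x * entry_sum y"
proof -
  have "(\<Sum>c\<in>UNIV. x $ fst c * y $ snd c) = (\<Sum>i\<in>UNIV. \<Sum>j\<in>UNIV. x $ i * y $ j)"
    by (simp add: sum.cartesian_product case_prod_beta)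
  thus ?thesis
    by (simp add: entry_sum_eq_sum kron_vec_vec_def sum_product)
qed

lemma newton_matrix_mult:
  "newton_matrix \<alpha> R x *v p =
     p - \<alpha> *\<^sub>R (R *v kron_vec_vec x p + R *v kron_vec_vec p x)"
proof -
  have 1: "kron_vec_mat x (mat 1) *v p = kron_vec_vec x p"
    by (simp add: kron_vec_mat_def kron_vec_vec_def matrix_vector_mult_def vec_eq_iff mat_def
        if_distrib[of "\<lambda>t. _ * t * _"] cong: if_cong)
  have 2: "kron_mat_vec (mat 1) x *v p = kron_vec_vec p x"
    by (simp add: kron_mat_vec_def kron_vec_vec_def matrix_vector_mult_def vec_eq_iff mat_def
        mult_ac if_distrib[of "\<lambda>t. _ * (_ * t)"] cong: if_cong)
  show ?thesis
    by (simp add: newton_matrix_def matrix_vector_mult_diff_rdistrib scaleR_matrix_vector_assoc[symmetric]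
        matrix_vector_mul_assoc[symmetric] matrix_vector_mult_add_rdistrib
        matrix_vector_right_distrib 1 2)
qed

section \<open>Nonnegative maps that contract entry sums\<close>

text \<open>
  From \<open>p = b + T p\<close> the negative part of \<open>p\<close> is bounded by its own image under \<open>T\<close>, and
  \<open>c < 1\<close> forces its entry sum to vanish.
\<close>

lemma contraction_solution_nonneg:
  fixes T :: "real^'n \<Rightarrow> real^'n"
  assumes lin: "linear T" and pos: "\<And>y. 0 \<le> y \<Longrightarrow> 0 \<le> T y"
    and sum: "\<And>y. entry_sum (T y) = c * entry_sum y" and c: "c < 1"
    and b: "0 \<le> p - T p"
  shows "0 \<le> p"
proof -
  define m :: "real^'n" where "m = (\<chi> i. max 0 (- p $ i))"
  have m0: "0 \<le> m" and "0 \<le> p + m"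
    by (auto simp: m_def less_eq_vec_def)
  hence "0 \<le> T p + T m"
    using pos[of "p + m"] by (simp add: linear_add[OF lin])
  hence lower: "0 \<le> T p $ i + T m $ i" for i
    by (simp add: less_eq_vec_def)
  have "m $ i \<le> T m $ i" for i
  proof -
    have "T p $ i \<le> p $ i" "0 \<le> T m $ i" "m $ i = max 0 (- p $ i)"
      using b pos[OF m0] by (auto simp: less_eq_vec_def m_def)
    thus ?thesis
      using lower[of i] by linarith
  qed
  hence "m \<le> T m"
    by (simp add: less_eq_vec_def)
  hence "(1 - c) * entry_sum m \<le> 0"
    using entry_sum_mono[of m "T m"] by (simp add: sum algebra_simps)
  hence "entry_sum m \<le> 0"
    using c by (simp add: mult_le_0_iff)
  hence "m = 0"
    using m0 by (rule entry_sum_zero_imp_zero[rotated])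
  hence "max 0 (- p $ i) = 0" for i
    by (simp add: m_def vec_eq_iff)
  hence "0 \<le> p $ i" for i
    by (metis max.cobounded2 neg_le_0_iff_le)
  thus ?thesis
    by (simp add: less_eq_vec_def)
qed

text \<open>Both \<open>p\<close> and \<open>- p\<close> have the nonnegative image 0, so both are nonnegative.\<close>

lemma contraction_kernel_zero:
  fixes T :: "real^'n \<Rightarrow> real^'n"
  assumes lin: "linear T" and pos: "\<And>y. 0 \<le> y \<Longrightarrow> 0 \<le> T y"
    and sum: "\<And>y. entry_sum (T y) = c * entry_sum y" and c: "c < 1"
    and p: "p - T p = 0"
  shows "p = 0"
proof (rule order_antisym)
  show "0 \<le> p"
    using contraction_solution_nonneg[OF lin pos sum c, of p] p by simp
  have "0 \<le> - p"
    using contraction_solution_nonneg[OF lin pos sum c, of "- p"] p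
    by (simp add: linear_neg[OF lin])
  thus "p \<le> 0"
    by simp
qed

lemma contraction_solution_unique:
  fixes T :: "real^'n \<Rightarrow> real^'n"
  assumes lin: "linear T" and pos: "\<And>y. 0 \<le> y \<Longrightarrow> 0 \<le> T y"
    and sum: "\<And>y. entry_sum (T y) = c * entry_sum y" and c: "c < 1"
  shows "\<exists>!p. p - T p = b"
proof -
  have L: "linear (\<lambda>p. p - T p)"
    by (intro linear_compose_sub lin linear_id[unfolded id_def])
  have "inj (\<lambda>p. p - T p)"
    unfolding linear_injective_0[OF L] using contraction_kernel_zero[OF lin pos sum c] by blast
  moreover from this have "surj (\<lambda>p. p - T p)"
    using linear_injective_imp_surjective[OF L] by simp
  ultimately show ?thesis
    using bij_iff[of "\<lambda>p. p - T p"] by (simp add: bij_def)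
qed

section \<open>The multilinear PageRank problem\<close>

text \<open>The tensor enters through the stochasticity of the columns of its flattening.\<close>

locale pagerank_problem =
  fixes \<alpha> :: real and R :: "real^('n \<times> 'n)^'n" and v :: "real^'n"
  assumes R_nonneg: "\<And>i c. 0 \<le> R $ i $ c"
    and R_colsum: "\<And>c. (\<Sum>i\<in>UNIV. R $ i $ c) = 1"
    and v: "stochastic_vec v"
    and \<alpha>_nonneg: "0 \<le> \<alpha>" and \<alpha>_less: "\<alpha> < 1 / 2"
begin

lemma mult_kron_nonneg: "0 \<le> x \<Longrightarrow> 0 \<le> y \<Longrightarrow> 0 \<le> R *v kron_vec_vec x y"
  by (auto simp: less_eq_vec_def matrix_vector_mult_def kron_vec_vec_def R_nonneg
      intro!: sum_nonneg mult_nonneg_nonneg)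

lemma entry_sum_mult: "entry_sum (R *v w) = entry_sum w"
proof -
  have "entry_sum (R *v w) = (\<Sum>i\<in>UNIV. \<Sum>c\<in>UNIV. R $ i $ c * w $ c)"
    by (simp add: entry_sum_eq_sum matrix_vector_mult_def)
  also have "\<dots> = (\<Sum>c\<in>UNIV. (\<Sum>i\<in>UNIV. R $ i $ c) * w $ c)"
    by (subst sum.swap) (simp add: sum_distrib_right)
  finally show ?thesis
    by (simp add: R_colsum entry_sum_eq_sum)
qed

lemma entry_sum_mult_kron: "entry_sum (R *v kron_vec_vec x y) = entry_sum x * entry_sum y"
  by (simp add: entry_sum_mult entry_sum_kron)

lemma entry_sum_residual:
  "entry_sum (residual \<alpha> R v x) = (1 - entry_sum x) * (1 - \<alpha> - \<alpha> * entry_sum x)"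
proof -
  have "entry_sum v = 1"
    using v by (simp add: stochastic_vec_iff)
  thus ?thesis
    by (simp add: residual_def entry_sum_add entry_sum_diff entry_sum_scaleR entry_sum_mult_kron
        algebra_simps)
qed

text \<open>
  For \<open>x = y\<close> this is the part that the Newton matrix subtracts from the identity. In general
  it maps \<open>x - y\<close> to the difference of the quadratic terms at \<open>x\<close> and \<open>y\<close>.
\<close>

definition polarization :: "real^'n \<Rightarrow> real^'n \<Rightarrow> real^'n \<Rightarrow> real^'n" where
  "polarization x y u = \<alpha> *\<^sub>R (R *v kron_vec_vec x u + R *v kron_vec_vec u y)"

lemma linear_polarization: "linear (polarization x y)"
  unfolding polarization_def
  using bilinear_mult_kron[of R] unfolding bilinear_def
  by (intro linear_compose_scale_right linear_compose_add) auto

lemma polarization_nonneg: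
  "0 \<le> x \<Longrightarrow> 0 \<le> y \<Longrightarrow> 0 \<le> u \<Longrightarrow> 0 \<le> polarization x y u"
  unfolding polarization_def
  using mult_kron_nonneg[of x u] mult_kron_nonneg[of u y] \<alpha>_nonneg
  by (simp add: scaleR_nonneg_nonneg)

lemma entry_sum_polarization:
  "entry_sum (polarization x y u) = \<alpha> * (entry_sum x + entry_sum y) * entry_sum u"
  by (simp add: polarization_def entry_sum_add entry_sum_scaleR entry_sum_mult_kron algebra_simps)

lemma polarization_factor_less_one:
  assumes "entry_sum x \<le> 1" "entry_sum y \<le> 1"
  shows "\<alpha> * (entry_sum x + entry_sum y) < 1"
proof -
  have "\<alpha> * (entry_sum x + entry_sum y) \<le> \<alpha> * 2"
    using assms \<alpha>_nonneg by (intro mult_left_mono) auto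
  thus ?thesis
    using \<alpha>_less by simp
qed

lemma newton_matrix_polarization: "newton_matrix \<alpha> R x *v p = p - polarization x x p"
  by (simp add: newton_matrix_mult polarization_def)

lemma newton_step_unique:
  assumes "0 \<le> x" "entry_sum x \<le> 1"
  shows "\<exists>!p. newton_matrix \<alpha> R x *v p = b"
  unfolding newton_matrix_polarization
  using assms
  by (intro contraction_solution_unique[OF linear_polarization _ entry_sum_polarization]
      polarization_nonneg polarization_factor_less_one)

lemma newton_step_nonneg:
  assumes "0 \<le> x" "entry_sum x \<le> 1" "0 \<le> newton_matrix \<alpha> R x *v p"
  shows "0 \<le> p"
  using contraction_solution_nonneg[OF linear_polarization _ entry_sum_polarization, of x x p]
    polarization_nonneg[of x x] polarization_factor_less_one[of x x] assms
  unfolding newton_matrix_polarization by blast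

lemma entry_sum_newton_matrix:
  "entry_sum (newton_matrix \<alpha> R x *v p) = (1 - 2 * \<alpha> * entry_sum x) * entry_sum p"
  by (simp add: newton_matrix_polarization entry_sum_diff entry_sum_polarization algebra_simps)

text \<open>
  The residual is quadratic, so its Taylor expansion stops at second order, and the Newton step
  cancels the terms of order zero and one.
\<close>

lemma residual_newton_step:
  assumes "newton_matrix \<alpha> R x *v p = residual \<alpha> R v x"
  shows "residual \<alpha> R v (x + p) = \<alpha> *\<^sub>R (R *v kron_vec_vec p p)"
proof -
  have "residual \<alpha> R v (x + p) =
      residual \<alpha> R v x - newton_matrix \<alpha> R x *v p + \<alpha> *\<^sub>R (R *v kron_vec_vec p p)"
    by (simp add: residual_def newton_matrix_mult kron_ladd kron_radd algebra_simps)
  thus ?thesis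
    by (simp add: assms)
qed

text \<open>
  Two solutions differ by a fixed point of a nonnegative linear map that multiplies entry sums by
  \<open>2 \<alpha> < 1\<close>, and such a map fixes only 0.
\<close>

lemma multilinear_pagerank_unique:
  assumes x: "multilinear_pagerank \<alpha> R v x" and y: "multilinear_pagerank \<alpha> R v y"
  shows "x = y"
proof -
  have x0: "0 \<le> x" "entry_sum x \<le> 1" and y0: "0 \<le> y" "entry_sum y \<le> 1"
    using x y by (auto simp: multilinear_pagerank_def stochastic_vec_iff)
  have "x - y = \<alpha> *\<^sub>R (R *v kron_vec_vec x x) - \<alpha> *\<^sub>R (R *v kron_vec_vec y y)"
    using x y unfolding multilinear_pagerank_def by (metis add_diff_cancel_right)
  also have "\<dots> = polarization x y (x - y)"
    by (simp add: polarization_def kron_lsub kron_rsub algebra_simps)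
  finally have "(x - y) - polarization x y (x - y) = 0"
    by simp
  hence "x - y = 0"
    using contraction_kernel_zero[OF linear_polarization _ entry_sum_polarization, of x y "x - y"]
      polarization_nonneg[of x y] polarization_factor_less_one[of x y] x0 y0 by blast
  thus ?thesis
    by simp
qed

section \<open>Invariants of the Newton iteration\<close>

definition feasible :: "real^'n \<Rightarrow> bool" where
  "feasible x \<longleftrightarrow> 0 \<le> x \<and> entry_sum x \<le> 1 \<and> 0 \<le> residual \<alpha> R v x"

lemma feasible_zero: "feasible 0"
proof -
  have "residual \<alpha> R v 0 = (1 - \<alpha>) *\<^sub>R v"
    by (simp add: residual_def bilinear_lzero[OF bilinear_mult_kron])
  thus ?thesis
    using v \<alpha>_less
    by (simp add: feasible_def entry_sum_zero stochastic_vec_iff scaleR_nonneg_nonneg)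
qed

lemma slope_bound:
  assumes "entry_sum x \<le> 1"
  shows "1 - 2 * \<alpha> \<le> 1 - 2 * \<alpha> * entry_sum x"
  using mult_left_mono[OF assms \<alpha>_nonneg] by simp

lemma slope_pos: "entry_sum x \<le> 1 \<Longrightarrow> 0 < 1 - 2 * \<alpha> * entry_sum x"
  using slope_bound[of x] \<alpha>_less by simp

lemma entry_sum_newton_step:
  assumes x: "entry_sum x \<le> 1" and p: "newton_matrix \<alpha> R x *v p = residual \<alpha> R v x"
  shows "1 - entry_sum (x + p) = \<alpha> * (1 - entry_sum x)\<^sup>2 / (1 - 2 * \<alpha> * entry_sum x)"
proof -
  let ?d = "1 - 2 * \<alpha> * entry_sum x"
  have "?d * entry_sum p = (1 - entry_sum x) * (1 - \<alpha> - \<alpha> * entry_sum x)"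
    using p entry_sum_newton_matrix[of x p] entry_sum_residual[of x] by simp
  hence "(1 - entry_sum (x + p)) * ?d = \<alpha> * (1 - entry_sum x)\<^sup>2"
    by (simp add: entry_sum_add algebra_simps power2_eq_square)
  thus ?thesis
    using slope_pos[OF x] by (simp add: eq_divide_eq)
qed

lemma entry_sum_residual_newton_step:
  assumes x: "entry_sum x \<le> 1" and p: "newton_matrix \<alpha> R x *v p = residual \<alpha> R v x"
  shows "entry_sum (residual \<alpha> R v (x + p)) =
    \<alpha> * (entry_sum (residual \<alpha> R v x))\<^sup>2 /
      ((1 - 2 * \<alpha>)\<^sup>2 + 4 * \<alpha> * entry_sum (residual \<alpha> R v x))"
proof -
  let ?d = "1 - 2 * \<alpha> * entry_sum x" and ?F = "entry_sum (residual \<alpha> R v x)"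
  have sp: "entry_sum p = ?F / ?d"
    using p entry_sum_newton_matrix[of x p] slope_pos[OF x] by (simp add: field_simps)
  \<comment> \<open>the discriminant of \<open>\<alpha> s\<^sup>2 - s + (1 - \<alpha>) - F\<close>, a polynomial with root \<open>s = entry_sum x\<close>\<close>
  have disc: "?d\<^sup>2 = (1 - 2 * \<alpha>)\<^sup>2 + 4 * \<alpha> * ?F"
    by (simp add: entry_sum_residual algebra_simps power2_eq_square)
  have "entry_sum (residual \<alpha> R v (x + p)) = \<alpha> * (entry_sum p)\<^sup>2"
    by (simp add: residual_newton_step[OF p] entry_sum_scaleR entry_sum_mult_kron power2_eq_square)
  also have "\<dots> = \<alpha> * ?F\<^sup>2 / ?d\<^sup>2"
    by (simp add: sp power_divide)
  finally show ?thesis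
    by (simp add: disc)
qed

lemma feasible_newton_step:
  assumes x: "feasible x" and p: "newton_matrix \<alpha> R x *v p = residual \<alpha> R v x"
  shows "feasible (x + p)" and "0 \<le> p"
proof -
  have x': "0 \<le> x" "entry_sum x \<le> 1" "0 \<le> residual \<alpha> R v x"
    using x by (auto simp: feasible_def)
  show p0: "0 \<le> p"
    using newton_step_nonneg[of x p] x' p by simp
  have "0 \<le> \<alpha> * (1 - entry_sum x)\<^sup>2 / (1 - 2 * \<alpha> * entry_sum x)"
    using slope_pos[OF x'(2)] \<alpha>_nonneg by simp
  hence "entry_sum (x + p) \<le> 1"
    using entry_sum_newton_step[OF x'(2) p] by simp
  thus "feasible (x + p)"
    using x' p0 \<alpha>_nonneg mult_kron_nonneg[OF p0 p0]
    by (simp add: feasible_def residual_newton_step[OF p] scaleR_nonneg_nonneg)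
qed

lemma newton_iterates_feasible:
  assumes "newton_iterates \<alpha> R v x"
  shows "feasible (x k)"
proof (induction k)
  case 0
  show ?case
    using assms feasible_zero by (simp add: newton_iterates_def)
next
  case (Suc k)
  obtain p where "newton_matrix \<alpha> R (x k) *v p = residual \<alpha> R v (x k)" "x (Suc k) = x k + p"
    using assms unfolding newton_iterates_def by blast
  thus ?case
    using feasible_newton_step(1)[OF Suc] by simp
qed

lemma feasible_step_unique:
  "feasible x \<Longrightarrow> \<exists>!p. newton_matrix \<alpha> R x *v p = residual \<alpha> R v x"
  by (rule newton_step_unique) (auto simp: feasible_def)

lemma newton_iterates_exists_unique: "\<exists>!x. newton_iterates \<alpha> R v x"
proof (rule ex_ex1I)
  define step where "step y = (THE p. newton_matrix \<alpha> R y *v p = residual \<alpha> R v y)" for y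
  define x where "x = rec_nat 0 (\<lambda>_ y. y + step y)"
  have step: "newton_matrix \<alpha> R y *v step y = residual \<alpha> R v y" if "feasible y" for y
    unfolding step_def by (rule theI'[OF feasible_step_unique[OF that]])
  have x: "x 0 = 0" "x (Suc k) = x k + step (x k)" for k
    by (simp_all add: x_def)
  have "feasible (x k)" for k
    by (induction k) (auto simp: x feasible_zero intro: feasible_newton_step step)
  hence "newton_iterates \<alpha> R v x"
    unfolding newton_iterates_def using x step by blast
  thus "\<exists>x. newton_iterates \<alpha> R v x"
    by blast
next
  fix x y
  assume x: "newton_iterates \<alpha> R v x" and y: "newton_iterates \<alpha> R v y"
  have "x k = y k" for k
  proof (induction k)
    case 0
    show ?case
      using x y by (simp add: newton_iterates_def)
  next
    case (Suc k)
    show ?case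
      using x y Suc feasible_step_unique[OF newton_iterates_feasible[OF x, of k]]
      unfolding newton_iterates_def by metis
  qed
  thus "x = y" ..
qed

section \<open>Convergence of the Newton iteration\<close>

context
  fixes x :: "nat \<Rightarrow> real^'n"
  assumes iterates: "newton_iterates \<alpha> R v x"
begin

lemma iterate_bounds: "0 \<le> x k" "entry_sum (x k) \<le> 1" "0 \<le> residual \<alpha> R v (x k)"
  using newton_iterates_feasible[OF iterates, of k] by (auto simp: feasible_def)

lemma iterate_step:
  obtains p where "newton_matrix \<alpha> R (x k) *v p = residual \<alpha> R v (x k)" "x (Suc k) = x k + p"
  using iterates unfolding newton_iterates_def by blast

lemma iterates_increasing: "x k \<le> x (Suc k)"
proof -
  obtain p where p: "newton_matrix \<alpha> R (x k) *v p = residual \<alpha> R v (x k)" "x (Suc k) = x k + p"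
    by (rule iterate_step)
  show ?thesis
    using feasible_newton_step(2)[OF newton_iterates_feasible[OF iterates] p(1)] p(2) by simp
qed

lemma iterates_residual_recurrence:
  "entry_sum (residual \<alpha> R v (x (Suc k))) =
    \<alpha> * (entry_sum (residual \<alpha> R v (x k)))\<^sup>2 /
      ((1 - 2 * \<alpha>)\<^sup>2 + 4 * \<alpha> * entry_sum (residual \<alpha> R v (x k)))"
proof -
  obtain p where p: "newton_matrix \<alpha> R (x k) *v p = residual \<alpha> R v (x k)" "x (Suc k) = x k + p"
    by (rule iterate_step)
  show ?thesis
    using entry_sum_residual_newton_step[OF iterate_bounds(2) p(1)] p(2) by simp
qed

lemma iterates_entry_sum_recurrence:
  "1 - entry_sum (x (Suc k)) =
    \<alpha> * (1 - entry_sum (x k))\<^sup>2 / (1 - 2 * \<alpha> * entry_sum (x k))"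
proof -
  obtain p where p: "newton_matrix \<alpha> R (x k) *v p = residual \<alpha> R v (x k)" "x (Suc k) = x k + p"
    by (rule iterate_step)
  show ?thesis
    using entry_sum_newton_step[OF iterate_bounds(2) p(1)] p(2) by simp
qed

text \<open>
  Dropping the square \<open>(1 - 2 \<alpha>)\<^sup>2\<close> in the denominator of the recurrence leaves a quarter of
  the previous entry sum.
\<close>

lemma iterates_residual_bound:
  "entry_sum (residual \<alpha> R v (x (Suc k))) \<le> \<alpha> * (1 - \<alpha>)\<^sup>2 * (1 / 4 ^ k)"
proof (induction k)
  case 0
  have "entry_sum (residual \<alpha> R v (x 0)) = 1 - \<alpha>"
    using iterates by (simp add: newton_iterates_def entry_sum_residual entry_sum_zero)
  moreover have "(1 - 2 * \<alpha>)\<^sup>2 + 4 * \<alpha> * (1 - \<alpha>) = 1"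
    by (simp add: algebra_simps power2_eq_square)
  ultimately show ?case
    using iterates_residual_recurrence[of 0] by simp
next
  case (Suc k)
  define F where "F = entry_sum (residual \<alpha> R v (x (Suc k)))"
  have F: "0 \<le> F"
    unfolding F_def by (intro entry_sum_nonneg iterate_bounds)
  have pos: "0 < (1 - 2 * \<alpha>)\<^sup>2 + 4 * \<alpha> * F"
    using F \<alpha>_nonneg \<alpha>_less by (intro add_pos_nonneg) auto
  have "\<alpha> * F\<^sup>2 \<le> F / 4 * ((1 - 2 * \<alpha>)\<^sup>2 + 4 * \<alpha> * F)"
  proof -
    have "0 \<le> F / 4 * (1 - 2 * \<alpha>)\<^sup>2"
      using F by simp
    thus ?thesis
      by (simp add: distrib_left power2_eq_square mult_ac)
  qed
  hence "\<alpha> * F\<^sup>2 / ((1 - 2 * \<alpha>)\<^sup>2 + 4 * \<alpha> * F) \<le> F / 4"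
    using pos by (simp add: pos_divide_le_eq)
  hence "entry_sum (residual \<alpha> R v (x (Suc (Suc k)))) \<le> F / 4"
    using iterates_residual_recurrence[of "Suc k"] by (simp add: F_def)
  also have "\<dots> \<le> \<alpha> * (1 - \<alpha>)\<^sup>2 * (1 / 4 ^ Suc k)"
    using Suc by (simp add: F_def)
  finally show ?case .
qed

lemma iterates_entry_sum_tendsto: "(\<lambda>k. entry_sum (x k)) \<longlonglongrightarrow> 1"
proof -
  let ?F = "\<lambda>k. entry_sum (residual \<alpha> R v (x k))"
  have "(\<lambda>k. \<alpha> * (1 - \<alpha>)\<^sup>2 * (1 / 4) ^ k) \<longlonglongrightarrow> \<alpha> * (1 - \<alpha>)\<^sup>2 * 0"
    by (intro tendsto_intros LIMSEQ_realpow_zero) auto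
  hence "(\<lambda>k. \<alpha> * (1 - \<alpha>)\<^sup>2 * (1 / 4 ^ k)) \<longlonglongrightarrow> 0"
    by (simp add: power_divide)
  hence "(\<lambda>k. ?F (Suc k)) \<longlonglongrightarrow> 0"
    by (rule tendsto_sandwich[OF _ _ tendsto_const, rotated 2])
      (intro always_eventually allI entry_sum_nonneg iterate_bounds iterates_residual_bound)+
  hence "?F \<longlonglongrightarrow> 0"
    by (rule LIMSEQ_imp_Suc)
  hence lim: "(\<lambda>k. ?F k / (1 - 2 * \<alpha>)) \<longlonglongrightarrow> 0"
    using tendsto_divide[of ?F 0 sequentially "\<lambda>_. 1 - 2 * \<alpha>" "1 - 2 * \<alpha>"] \<alpha>_less by simp
  have upper: "1 - entry_sum (x k) \<le> ?F k / (1 - 2 * \<alpha>)" for k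
  proof -
    have "1 - 2 * \<alpha> \<le> 1 - \<alpha> - \<alpha> * entry_sum (x k)"
      using mult_left_mono[OF iterate_bounds(2)[of k] \<alpha>_nonneg] by simp
    hence "(1 - entry_sum (x k)) * (1 - 2 * \<alpha>) \<le> ?F k"
      unfolding entry_sum_residual using iterate_bounds(2)[of k] by (intro mult_left_mono) auto
    thus ?thesis
      using \<alpha>_less by (simp add: pos_le_divide_eq)
  qed
  have "(\<lambda>k. 1 - entry_sum (x k)) \<longlonglongrightarrow> 0"
    by (rule tendsto_sandwich[OF _ _ tendsto_const lim]) (auto simp: upper iterate_bounds)
  from tendsto_diff[OF tendsto_const[of 1] this] show ?thesis
    by simp
qed

text \<open>
  The entry sums tend to 1, so no mass is lost in the monotone limit. The limit residual is then
  nonnegative with entry sum 0, hence 0.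
\<close>

lemma iterates_limit:
  obtains z where "x \<longlonglongrightarrow> z" and "\<And>k. x k \<le> z" and "multilinear_pagerank \<alpha> R v z"
proof -
  have incr: "incseq (\<lambda>k. x k $ i)" for i
    using iterates_increasing by (intro incseq_SucI) (auto simp: less_eq_vec_def)
  have "x k $ i \<le> 1" for k i
    using entry_le_entry_sum[OF iterate_bounds(1)] iterate_bounds(2) order_trans by blast
  hence "\<exists>l. (\<lambda>k. x k $ i) \<longlonglongrightarrow> l \<and> (\<forall>k. x k $ i \<le> l)" for i
    using incseq_convergent[OF incr] by metis
  then obtain l where l: "\<And>i. (\<lambda>k. x k $ i) \<longlonglongrightarrow> l i" "\<And>i k. x k $ i \<le> l i"
    by metis
  define z where "z = (\<chi> i. l i)"
  have lim: "x \<longlonglongrightarrow> z"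
    by (rule vec_tendstoI) (simp add: z_def l)
  have le: "x k \<le> z" for k
    by (simp add: less_eq_vec_def z_def l)
  have "(\<lambda>k. entry_sum (x k)) \<longlonglongrightarrow> entry_sum z"
    unfolding entry_sum_def by (intro tendsto_intros lim)
  hence sum: "entry_sum z = 1"
    using iterates_entry_sum_tendsto LIMSEQ_unique by blast
  have "0 \<le> z"
    using iterate_bounds(1)[of 0] le[of 0] by (rule order_trans)
  hence st: "stochastic_vec z"
    by (simp add: stochastic_vec_iff sum)
  have "(\<lambda>k. residual \<alpha> R v (x k)) \<longlonglongrightarrow> residual \<alpha> R v z"
    unfolding residual_def
    by (intro tendsto_intros bounded_bilinear.tendsto[OF
          bilinear_conv_bounded_bilinear[THEN iffD1, OF bilinear_mult_kron]] lim)
  hence "0 \<le> residual \<alpha> R v z $ i" for i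
    using iterate_bounds(3)
    by (intro tendsto_lowerbound[OF tendsto_vec_nth]) (auto simp: less_eq_vec_def)
  hence "0 \<le> residual \<alpha> R v z"
    by (simp add: less_eq_vec_def)
  hence "residual \<alpha> R v z = 0"
    by (rule entry_sum_zero_imp_zero) (simp add: entry_sum_residual sum)
  hence "multilinear_pagerank \<alpha> R v z"
    using st by (simp add: multilinear_pagerank_def residual_def)
  with lim le show thesis
    by (rule that)
qed

text \<open>
  The error \<open>z - x k\<close> is nonnegative, so its 1-norm is \<open>1 - entry_sum (x k)\<close>. The constant
  combines the factor of the scalar recurrence with the Cauchy-Schwarz bound of the 1-norm by the
  Euclidean norm.
\<close>

lemma iterates_converge_quadratically:
  assumes z: "multilinear_pagerank \<alpha> R v z"
  shows "converges_quadratically x z"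
proof -
  have lim: "x \<longlonglongrightarrow> z" and le: "x k \<le> z" for k
    using iterates_limit multilinear_pagerank_unique[OF z] by metis+
  define N where "N = norm (vec 1 :: real^'n)"
  have err: "entry_sum (z - x k) = 1 - entry_sum (x k)" for k
    using z by (simp add: entry_sum_diff multilinear_pagerank_def stochastic_vec_iff)
  have "norm (x (Suc k) - z) \<le> \<alpha> / (1 - 2 * \<alpha>) * N\<^sup>2 * (norm (x k - z))\<^sup>2" for k
  proof -
    have "norm (x (Suc k) - z) \<le> 1 - entry_sum (x (Suc k))"
      using norm_le_entry_sum[of "z - x (Suc k)"] le[of "Suc k"] err[of "Suc k"]
      by (simp add: norm_minus_commute)
    also have "\<dots> = \<alpha> * (1 - entry_sum (x k))\<^sup>2 / (1 - 2 * \<alpha> * entry_sum (x k))"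
      by (rule iterates_entry_sum_recurrence)
    also have "\<dots> \<le> \<alpha> * (1 - entry_sum (x k))\<^sup>2 / (1 - 2 * \<alpha>)"
      using slope_bound[OF iterate_bounds(2)[of k]] \<alpha>_less \<alpha>_nonneg
      by (intro divide_left_mono mult_pos_pos) auto
    also have "\<dots> = \<alpha> / (1 - 2 * \<alpha>) * (1 - entry_sum (x k))\<^sup>2"
      by simp
    also have "\<dots> \<le> \<alpha> / (1 - 2 * \<alpha>) * (N * norm (z - x k))\<^sup>2"
    proof (intro mult_left_mono power_mono)
      show "1 - entry_sum (x k) \<le> N * norm (z - x k)"
        using norm_cauchy_schwarz[of "vec 1" "z - x k"] err[of k]
        by (simp add: entry_sum_def N_def)
    qed (use iterate_bounds(2)[of k] \<alpha>_nonneg \<alpha>_less in auto)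
    finally show ?thesis
      by (simp add: power_mult_distrib norm_minus_commute mult.assoc)
  qed
  hence "\<forall>\<^sub>F k in sequentially.
      norm (x (Suc k) - z) \<le> \<alpha> / (1 - 2 * \<alpha>) * N\<^sup>2 * (norm (x k - z))\<^sup>2"
    by (rule always_eventually[OF allI])
  with lim show ?thesis
    unfolding converges_quadratically_def by blast
qed

end

lemma multilinear_pagerank_exists_unique: "\<exists>!z. multilinear_pagerank \<alpha> R v z"
proof -
  obtain x where "newton_iterates \<alpha> R v x"
    using newton_iterates_exists_unique by blast
  then obtain z where "multilinear_pagerank \<alpha> R v z"
    by (rule iterates_limit)
  thus ?thesis
    using multilinear_pagerank_unique by blast
qed

end

lemma pagerank_problem_flattening:
  assumes "stochastic_tensor P" "stochastic_vec v" "0 \<le> \<alpha>" "\<alpha> < 1 / 2"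
  shows "pagerank_problem \<alpha> (flattening P) v"
  using assms by unfold_locales (auto simp: flattening_def stochastic_tensor_def)

theorem theorem5p6:
  fixes P :: "real^'n^'n^'n" and v :: "real^'n" and \<alpha> :: real
    and R :: "real^('n \<times> 'n)^'n" and f :: "real^'n \<Rightarrow> real^'n"
  assumes "stochastic_tensor P" and "stochastic_vec v" and "0 \<le> \<alpha>" and "\<alpha> < 1 / 2"
    and R: "R = flattening P"
    and f: "f = residual \<alpha> R v"
  shows "(\<exists>!z. multilinear_pagerank \<alpha> R v z) \<and>
    (\<exists>!x. newton_iterates \<alpha> R v x) \<and>
    (\<forall>x. newton_iterates \<alpha> R v x \<longrightarrow>
      (\<forall>k. \<exists>!p. newton_matrix \<alpha> R (x k) *v p = f (x k)) \<and>
      (\<forall>k\<ge>1.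
        (\<forall>i. 0 \<le> f (x k) $ i) \<and>
        entry_sum (f (x k)) =
          \<alpha> * (entry_sum (f (x (k - 1))))\<^sup>2 /
            ((1 - 2 * \<alpha>)\<^sup>2 + 4 * \<alpha> * entry_sum (f (x (k - 1)))) \<and>
        entry_sum (f (x k)) \<le> \<alpha> * (1 - \<alpha>)\<^sup>2 * (1 / 4 ^ (k - 1))) \<and>
      (\<forall>z. multilinear_pagerank \<alpha> R v z \<longrightarrow> converges_quadratically x z))"
proof -
  interpret pagerank_problem \<alpha> R v
    unfolding R by (rule pagerank_problem_flattening) fact+
  have "(\<forall>k. \<exists>!p. newton_matrix \<alpha> R (x k) *v p = f (x k)) \<and>
      (\<forall>k\<ge>1.
        (\<forall>i. 0 \<le> f (x k) $ i) \<and>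
        entry_sum (f (x k)) =
          \<alpha> * (entry_sum (f (x (k - 1))))\<^sup>2 /
            ((1 - 2 * \<alpha>)\<^sup>2 + 4 * \<alpha> * entry_sum (f (x (k - 1)))) \<and>
        entry_sum (f (x k)) \<le> \<alpha> * (1 - \<alpha>)\<^sup>2 * (1 / 4 ^ (k - 1))) \<and>
      (\<forall>z. multilinear_pagerank \<alpha> R v z \<longrightarrow> converges_quadratically x z)"
    if x: "newton_iterates \<alpha> R v x" for x
  proof (intro conjI allI impI)
    show "\<exists>!p. newton_matrix \<alpha> R (x k) *v p = f (x k)" for k
      unfolding f by (rule feasible_step_unique[OF newton_iterates_feasible[OF x]])
    show "converges_quadratically x z" if "multilinear_pagerank \<alpha> R v z" for z
      by (rule iterates_converge_quadratically[OF x that])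
  next
    fix k :: nat
    assume "1 \<le> k"
    then obtain m where k: "k = Suc m"
      by (cases k) auto
    show "0 \<le> f (x k) $ i" for i
      using iterate_bounds(3)[OF x, of k] by (simp add: f less_eq_vec_def)
    show "entry_sum (f (x k)) = \<alpha> * (entry_sum (f (x (k - 1))))\<^sup>2 /
        ((1 - 2 * \<alpha>)\<^sup>2 + 4 * \<alpha> * entry_sum (f (x (k - 1))))"
      using iterates_residual_recurrence[OF x, of m] by (simp add: f k)
    show "entry_sum (f (x k)) \<le> \<alpha> * (1 - \<alpha>)\<^sup>2 * (1 / 4 ^ (k - 1))"
      using iterates_residual_bound[OF x, of m] by (simp add: f k)
  qed
  thus ?thesis
    using multilinear_pagerank_exists_unique newton_iterates_exists_unique by blast
qed

end
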